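(* Let $P$ be an $N\times N$ real matrix with non-negative entries and spectral radius $\rho(P)=1$, and assume there is a strictly positive vector $V>0$ with $V^TP=V^T$. Let $e=\frac1N(1,\dots,1)^T$. Then there is a unique vector $H_\infty\in\mathbb{R}^N$ such that $H_\infty+e$ is a right eigenvector of $P$ for the eigenvalue $1$ and, within each strongly connected component of $P$ of spectral radius one, the maximum of the entries of $H_\infty+e$ equals $1/N$; and for any fair negative-diffusion sequence $\mathcal{I}=\mathcal{I}^-$ for $(P,Pe-e)$ (defined in the context), the D-iteration history vectors $H_n(P,Pe-e,\mathcal{I})$ converge to $H_\infty$ as $n\to\infty$.
   Context: Let $\Omega=\{1,\dots,N\}$, let $I$ be the $N\times N$ identity matrix, and let $J_i$ be the matrix whose only non-zero entry is $(J_i)_{ii}=1$. The diffusion operators of $P$ are $P_i=I-J_i+PJ_i$. Given $B\in\mathbb{R}^N$ and a sequence $\mathcal{I}=\{i_1,i_2,\dots\}$ in $\Omega$, the D-iteration is $F_0=B$, $H_0=0$ and, for $n\ge1$, $F_n=P_{i_n}F_{n-1}$, $H_n=H_{n-1}+J_{i_n}F_{n-1}$; one writes $H_n=H_n(P,B,\mathcal{I})$. Let $\Omega_n^-=\{i\in\Omega:(F_n)_i\le0\}$ and $\Omega^-=\bigcup_n\Omega_n^-$. A sequence $\mathcal{I}$ is a fair negative-diffusion sequence, written $\mathcal{I}^-$, if at each step only a node with non-positive fluid is diffused, i.e. $(F_{n-1})_{i_n}\le0$ for all $n\ge1$, and every element of $\Omega^-$ occurs infinitely often in $\mathcal{I}$.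 The strongly connected components of $P$ are those of the directed graph on $\Omega$ with an edge $j\to i$ whenever $p_{ij}>0$; the spectral radius of a component is the spectral radius of the restriction of $P$ to the rows and columns indexed by that component. *)

theory Defs
  imports
    "Jordan_Normal_Form.Spectral_Radius"
    "Jordan_Normal_Form.DL_Submatrix"
    "Graph_Theory.Digraph_Component"
begin

text \<open>
  Throughout, a square matrix of dimension \<open>N\<close> is an element of \<open>carrier_mat N N\<close>, and
  the index set \<open>\<Omega> = {1, \<dots>, N}\<close> is rendered 0-based as \<open>{0..<N}\<close>.
\<close>

definition unit_diag_mat :: "nat \<Rightarrow> nat \<Rightarrow> real mat" where
  "unit_diag_mat N i = mat N N (\<lambda>(a, b). if a = i \<and> b = i then 1 else 0)"

definition diffusion_operator :: "real mat \<Rightarrow> nat \<Rightarrow> real mat" where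
  "diffusion_operator P i =
     1\<^sub>m (dim_row P) - unit_diag_mat (dim_row P) i + P * unit_diag_mat (dim_row P) i"

text \<open>
  A diffusion sequence \<open>i\<^sub>1, i\<^sub>2, \<dots>\<close> is a function \<open>s :: nat \<Rightarrow> nat\<close> with \<open>s n = i\<^sub>n\<close> for
  \<open>n \<ge> 1\<close>; the value \<open>s 0\<close> is never used.
\<close>

primrec fluid :: "real mat \<Rightarrow> real vec \<Rightarrow> (nat \<Rightarrow> nat) \<Rightarrow> nat \<Rightarrow> real vec" where
  "fluid P B s 0 = B"
| "fluid P B s (Suc n) = diffusion_operator P (s (Suc n)) *\<^sub>v fluid P B s n"

primrec history :: "real mat \<Rightarrow> real vec \<Rightarrow> (nat \<Rightarrow> nat) \<Rightarrow> nat \<Rightarrow> real vec" where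
  "history P B s 0 = 0\<^sub>v (dim_row P)"
| "history P B s (Suc n) =
     history P B s n + unit_diag_mat (dim_row P) (s (Suc n)) *\<^sub>v fluid P B s n"

definition nonpos_nodes :: "real mat \<Rightarrow> real vec \<Rightarrow> (nat \<Rightarrow> nat) \<Rightarrow> nat \<Rightarrow> nat set" where
  "nonpos_nodes P B s n = {i \<in> {0..<dim_row P}. fluid P B s n $ i \<le> 0}"

definition fair_negative_sequence :: "real mat \<Rightarrow> real vec \<Rightarrow> (nat \<Rightarrow> nat) \<Rightarrow> bool" where
  "fair_negative_sequence P B s \<longleftrightarrow>
     (\<forall>n\<ge>1. s n \<in> {0..<dim_row P}) \<and>
     (\<forall>n\<ge>1. fluid P B s (n - 1) $ s n \<le> 0) \<and>
     (\<forall>i \<in> (\<Union>n. nonpos_nodes P B s n). infinite {n. n \<ge> 1 \<and> s n = i})"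

text \<open>An arc from \<open>j\<close> to \<open>i\<close> corresponds to the entry in row \<open>i\<close> and column \<open>j\<close>.\<close>

definition matrix_digraph :: "real mat \<Rightarrow> (nat, nat \<times> nat) pre_digraph" where
  "matrix_digraph P =
     \<lparr> verts = {0..<dim_row P},
       arcs = {(j, i). j < dim_row P \<and> i < dim_row P \<and> P $$ (i, j) > 0},
       tail = fst, head = snd \<rparr>"

abbreviation strong_components :: "real mat \<Rightarrow> nat set set" where
  "strong_components P \<equiv> pre_digraph.sccs_verts (matrix_digraph P)"

definition real_spectral_radius :: "real mat \<Rightarrow> real" where
  "real_spectral_radius A = spectral_radius (map_mat complex_of_real A)"

definition component_spectral_radius :: "real mat \<Rightarrow> nat set \<Rightarrow> real" where
  "component_spectral_radius P C = real_spectral_radius (submatrix P C C)"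

definition uniform_vec :: "nat \<Rightarrow> real vec" where
  "uniform_vec N = vec N (\<lambda>_. 1 / real N)"

definition normalized_limit :: "nat \<Rightarrow> real mat \<Rightarrow> real vec \<Rightarrow> bool" where
  "normalized_limit N P H \<longleftrightarrow>
     H \<in> carrier_vec N \<and>
     eigenvector P (H + uniform_vec N) 1 \<and>
     (\<forall>C \<in> strong_components P. component_spectral_radius P C = 1 \<longrightarrow>
        Max ((\<lambda>i. (H + uniform_vec N) $ i) ` C) = 1 / real N)"

end

theory Submission
  imports Defs
begin

text \<open>
  Put \<open>x\<^sub>n = H\<^sub>n + e\<close>. The fluid is then \<open>F\<^sub>n = P x\<^sub>n - x\<^sub>n\<close>, so a diffusion at \<open>k\<close> replaces the
  coordinate \<open>k\<close> of \<open>x\<^sub>n\<close> by that of \<open>P x\<^sub>n\<close>, and the nonpositivity of the fluid at \<open>k\<close> means that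
  this does not increase it. The theorem is about this chaotic downward iteration, started at the
  constant vector \<open>e\<close>.

  The positive left eigenvector is a conserved weight: \<open>x\<close> and \<open>P x\<close> have the same weighted total.
  Therefore \<open>x \<le> P x\<close> already forces \<open>x = P x\<close> (\<open>subinvariant_imp_fixed\<close>), which has the following
  consequences. The absolute value of a fixed vector is fixed, so a zero of a fixed vector spreads to
  all nodes from which it can be reached. Every arc that starts in the support of a fixed vector has a
  way back (\<open>fixed_support_returns\<close>). So a fixed vector can be cut down to each strong component
  separately, and on one component any two fixed vectors are proportional.

  Spectral radius one has the same source: if \<open>\<bar>k\<bar> = 1\<close> for an eigenvalue \<open>k\<close> of a block, then the
  absolute values of its eigenvector are subinvariant, hence fixed. So a component has spectral radius
  one exactly when it carries a nonzero fixed vector (\<open>component_radius_eq_1_iff\<close>). Existence and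
  uniqueness of the normalized fixed vector \<open>z\<close> follow componentwise.

  For the convergence, \<open>z \<le> e\<close> and \<open>P\<close> is monotone, so the iterates decrease and stay above \<open>z\<close>. Their
  limit \<open>y\<close> has residual \<open>0\<close> at the nodes used infinitely often, and a nonnegative residual at the
  nodes whose fluid is always positive. By conservation \<open>y\<close> is fixed. Since \<open>z \<le> y \<le> e\<close>, it has
  the maximum \<open>1 / N\<close> that is prescribed for \<open>z\<close>, so \<open>y = z\<close> by uniqueness
  (\<open>downward_iteration_limit_normalized\<close>).
\<close>

section \<open>Invariant vectors of kernels with a positive conserved weight\<close>

text \<open>
  The entry \<open>p i j\<close> is read as the amount that one unit at \<open>j\<close> sends to \<open>i\<close>, and the total weighted
  by \<open>v\<close> is conserved. The exchange of \<open>x j\<close> by \<open>v j * x j\<close> would make \<open>p\<close> the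
  transition matrix of a Markov chain, and the results below are facts about its invariant signed
  measures. Conservation replaces the Perron--Frobenius theorem throughout.
\<close>

locale conservative_kernel =
  fixes S :: "'a set" and p :: "'a \<Rightarrow> 'a \<Rightarrow> real" and v :: "'a \<Rightarrow> real"
  assumes finite_S: "finite S"
    and p_nonneg: "\<And>i j. i \<in> S \<Longrightarrow> j \<in> S \<Longrightarrow> 0 \<le> p i j"
    and v_pos: "\<And>i. i \<in> S \<Longrightarrow> 0 < v i"
    and conserved: "\<And>j. j \<in> S \<Longrightarrow> (\<Sum>i\<in>S. v i * p i j) = v j"
begin

definition app :: "('a \<Rightarrow> real) \<Rightarrow> 'a \<Rightarrow> real" where
  "app x i = (\<Sum>j\<in>S. p i j * x j)"

definition fixed :: "('a \<Rightarrow> real) \<Rightarrow> bool" where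
  "fixed x \<longleftrightarrow> (\<forall>i\<in>S. app x i = x i)"

definition arc_rel :: "('a \<times> 'a) set" where
  "arc_rel = {(j, i). j \<in> S \<and> i \<in> S \<and> 0 < p i j}"

definition communicating_class :: "'a set \<Rightarrow> bool" where
  "communicating_class C \<longleftrightarrow> C \<noteq> {} \<and> C \<subseteq> S \<and>
     (\<forall>i\<in>C. \<forall>j. j \<in> C \<longleftrightarrow> j \<in> S \<and> (i, j) \<in> arc_rel\<^sup>* \<and> (j, i) \<in> arc_rel\<^sup>*)"

text \<open>
  For a communicating class this is recurrence of the Markov chain; stated through invariant vectors
  it can be compared directly with the spectral radius of a block.
\<close>

definition carries_fixed :: "'a set \<Rightarrow> bool" where
  "carries_fixed C \<longleftrightarrow> (\<exists>u. fixed u \<and> (\<forall>i\<in>S. 0 \<le> u i) \<and>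
     (\<forall>i\<in>S. i \<notin> C \<longrightarrow> u i = 0) \<and> (\<exists>i\<in>C. u i \<noteq> 0))"

definition normalized :: "real \<Rightarrow> ('a \<Rightarrow> real) \<Rightarrow> bool" where
  "normalized m x \<longleftrightarrow> fixed x \<and>
     (\<forall>C. communicating_class C \<and> carries_fixed C \<longrightarrow> Max (x ` C) = m)"

lemma app_mono: "(\<And>j. j \<in> S \<Longrightarrow> x j \<le> y j) \<Longrightarrow> i \<in> S \<Longrightarrow> app x i \<le> app y i"
  unfolding app_def by (intro sum_mono mult_left_mono p_nonneg) auto

lemma app_linear: "app (\<lambda>i. a * x i + b * y i) i = a * app x i + b * app y i"
  unfolding app_def by (simp add: sum_distrib_left sum.distrib algebra_simps)

lemma fixed_linear: "fixed x \<Longrightarrow> fixed y \<Longrightarrow> fixed (\<lambda>i. a * x i + b * y i)"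
  unfolding fixed_def app_linear by simp

lemma fixed_sum:
  assumes "finite A" "\<And>a. a \<in> A \<Longrightarrow> fixed (f a)"
  shows "fixed (\<lambda>i. \<Sum>a\<in>A. f a i)"
  using assms
proof (induction A rule: finite_induct)
  case empty
  then show ?case by (simp add: fixed_def app_def)
next
  case (insert a A)
  then show ?case using fixed_linear[of "f a" "\<lambda>i. \<Sum>a\<in>A. f a i" 1 1] by simp
qed

lemma weight_app: "(\<Sum>i\<in>S. v i * app x i) = (\<Sum>j\<in>S. v j * x j)"
proof -
  have "(\<Sum>i\<in>S. v i * app x i) = (\<Sum>i\<in>S. \<Sum>j\<in>S. v i * p i j * x j)"
    by (simp add: app_def sum_distrib_left mult.assoc)
  also have "\<dots> = (\<Sum>j\<in>S. \<Sum>i\<in>S. v i * p i j * x j)"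
    by (rule sum.swap)
  also have "\<dots> = (\<Sum>j\<in>S. (\<Sum>i\<in>S. v i * p i j) * x j)"
    by (simp add: sum_distrib_right)
  also have "\<dots> = (\<Sum>j\<in>S. v j * x j)"
    by (intro sum.cong) (auto simp: conserved)
  finally show ?thesis .
qed

text \<open>
  A vector and its image have the same weighted total, and the weights are positive; so an inequality
  between them that holds in every coordinate cannot be strict anywhere.
\<close>

lemma subinvariant_imp_fixed:
  assumes "\<And>i. i \<in> S \<Longrightarrow> x i \<le> app x i"
  shows "fixed x"
proof -
  have "(\<Sum>i\<in>S. v i * (app x i - x i)) = 0"
    using weight_app[of x] by (simp add: algebra_simps sum_subtractf)
  moreover have "0 \<le> v i * (app x i - x i)" if "i \<in> S" for i
    using assms[OF that] v_pos[OF that] by simp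
  ultimately have "\<forall>i\<in>S. v i * (app x i - x i) = 0"
    by (subst (asm) sum_nonneg_eq_0_iff[OF finite_S])
  then show ?thesis
    using v_pos unfolding fixed_def by fastforce
qed

lemma superinvariant_imp_fixed:
  assumes "\<And>i. i \<in> S \<Longrightarrow> app x i \<le> x i"
  shows "fixed x"
proof -
  have "fixed (\<lambda>i. - x i)"
    using assms by (intro subinvariant_imp_fixed) (auto simp: app_def sum_negf)
  then show ?thesis
    using fixed_linear[of "\<lambda>i. - x i" "\<lambda>i. - x i" "-1" 0] by simp
qed

lemma abs_app_le: "i \<in> S \<Longrightarrow> \<bar>app x i\<bar> \<le> app (\<lambda>j. \<bar>x j\<bar>) i"
  unfolding app_def
  by (rule order_trans[OF sum_abs]) (auto intro!: sum_mono simp: abs_mult p_nonneg)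

lemma fixed_abs: "fixed x \<Longrightarrow> fixed (\<lambda>i. \<bar>x i\<bar>)"
  by (rule subinvariant_imp_fixed) (metis abs_app_le fixed_def)

lemma fixed_zero_predecessor:
  assumes "fixed x" "x i = 0" "(j, i) \<in> arc_rel"
  shows "x j = 0"
proof -
  have ij: "i \<in> S" "j \<in> S" "0 < p i j"
    using assms(3) by (auto simp: arc_rel_def)
  \<comment> \<open>Passing to absolute values excludes that incoming terms of opposite sign cancel.\<close>
  have "(\<Sum>j\<in>S. p i j * \<bar>x j\<bar>) = 0"
    using fixed_abs[OF assms(1)] ij assms(2) by (simp add: fixed_def app_def)
  moreover have "\<And>j. j \<in> S \<Longrightarrow> 0 \<le> p i j * \<bar>x j\<bar>"
    using ij p_nonneg by simp
  ultimately have "\<forall>j\<in>S. p i j * \<bar>x j\<bar> = 0"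
    by (subst (asm) sum_nonneg_eq_0_iff[OF finite_S])
  then show ?thesis using ij by fastforce
qed

lemma fixed_zero_ancestor:
  assumes "(j, i) \<in> arc_rel\<^sup>*" "fixed x" "x i = 0"
  shows "x j = 0"
  using assms(1) assms(2,3)
  by (induction rule: converse_rtrancl_induct) (auto intro: fixed_zero_predecessor)

text \<open>
  Nothing that an invariant vector carries is ever lost: an arc \<open>j \<rightarrow> k\<close> without a way back would drain
  \<open>j\<close>. The set \<open>R\<close> of nodes reachable from \<open>k\<close> has no exit, so cutting \<open>\<bar>x\<bar>\<close> down to \<open>R\<close> gives a
  superinvariant vector, hence an invariant one. So \<open>\<bar>x\<bar>\<close> cut down to the complement of \<open>R\<close> is
  invariant as well. It vanishes at \<open>k\<close>, therefore also at \<open>j\<close>, which is impossible if \<open>j\<close> is outside \<open>R\<close>.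
\<close>

lemma fixed_support_returns:
  assumes "fixed x" "x j \<noteq> 0" "(j, k) \<in> arc_rel"
  shows "(k, j) \<in> arc_rel\<^sup>*"
proof (rule ccontr)
  assume no_return: "(k, j) \<notin> arc_rel\<^sup>*"
  define R where "R = {l. (k, l) \<in> arc_rel\<^sup>*}"
  define w where "w = (\<lambda>i. if i \<in> R then \<bar>x i\<bar> else 0)"
  have fixed_abs_x: "fixed (\<lambda>i. \<bar>x i\<bar>)"
    by (rule fixed_abs[OF assms(1)])
  have "app w i \<le> w i" if i: "i \<in> S" for i
  proof (cases "i \<in> R")
    case True
    have "app w i \<le> app (\<lambda>i. \<bar>x i\<bar>) i"
      using i by (intro app_mono) (auto simp: w_def)
    then show ?thesis using fixed_abs_x i True by (simp add: fixed_def w_def)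
  next
    case False
    have "p i l * w l = 0" if "l \<in> S" for l
    proof (cases "l \<in> R")
      case True
      then have "(l, i) \<notin> arc_rel"
        using False unfolding R_def by (auto intro: rtrancl_into_rtrancl)
      then show ?thesis using i that p_nonneg[OF i that] by (auto simp: arc_rel_def)
    qed (simp add: w_def)
    then show ?thesis using False by (simp add: app_def w_def)
  qed
  then have "fixed w" by (rule superinvariant_imp_fixed)
  then have "fixed (\<lambda>i. 1 * \<bar>x i\<bar> + (-1) * w i)"
    by (rule fixed_linear[OF fixed_abs_x])
  from fixed_zero_predecessor[OF this _ assms(3)] have "\<bar>x j\<bar> - w j = 0"
    by (simp add: w_def R_def)
  then show False
    using assms(2) no_return by (simp add: w_def R_def)
qed

text \<open>
  Arcs out of the support have a way back, so those between different classes start at zeros of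
  \<open>x\<close>: cutting \<open>x\<close> down to one class removes no contribution to that class and leaves none outside it.
\<close>

lemma fixed_restrict_class:
  assumes C: "communicating_class C" and x: "fixed x"
  shows "fixed (\<lambda>i. if i \<in> C then x i else 0)"
  unfolding fixed_def
proof
  fix i assume i: "i \<in> S"
  have "p i j * (if j \<in> C then x j else 0) = (if i \<in> C then p i j * x j else 0)" if j: "j \<in> S" for j
  proof (cases "p i j = 0 \<or> x j = 0")
    case False
    then have arc: "(j, i) \<in> arc_rel"
      using i j p_nonneg[OF i j] by (auto simp: arc_rel_def)
    moreover have "(i, j) \<in> arc_rel\<^sup>*"
      using fixed_support_returns[OF x _ arc] False by simp
    ultimately have "i \<in> C \<longleftrightarrow> j \<in> C"
      using C i j unfolding communicating_class_def by blast
    then show ?thesis by simp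
  qed auto
  then have "app (\<lambda>i. if i \<in> C then x i else 0) i = (\<Sum>j\<in>S. if i \<in> C then p i j * x j else 0)"
    unfolding app_def by (rule sum.cong[OF refl])
  also have "\<dots> = (if i \<in> C then app x i else 0)"
    by (simp add: app_def)
  finally show "app (\<lambda>i. if i \<in> C then x i else 0) i = (if i \<in> C then x i else 0)"
    using x i by (simp add: fixed_def)
qed

lemma class_carries_fixed_if_nonzero:
  assumes C: "communicating_class C" and x: "fixed x" and i: "i \<in> C" "x i \<noteq> 0"
  shows "carries_fixed C"
  unfolding carries_fixed_def
proof (intro exI conjI)
  show "fixed (\<lambda>i. if i \<in> C then \<bar>x i\<bar> else 0)"
    by (rule fixed_restrict_class[OF C fixed_abs[OF x]])
qed (use i in auto)

lemma class_exists:
  assumes "i \<in> S"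
  obtains C where "communicating_class C" "i \<in> C"
proof
  let ?C = "{j \<in> S. (i, j) \<in> arc_rel\<^sup>* \<and> (j, i) \<in> arc_rel\<^sup>*}"
  show "communicating_class ?C"
    unfolding communicating_class_def using assms by (auto intro: rtrancl_trans)
  show "i \<in> ?C" using assms by simp
qed

lemma class_finite: "communicating_class C \<Longrightarrow> finite C"
  unfolding communicating_class_def using finite_S finite_subset by blast

lemma class_connected: "communicating_class C \<Longrightarrow> i \<in> C \<Longrightarrow> j \<in> C \<Longrightarrow> (i, j) \<in> arc_rel\<^sup>*"
  unfolding communicating_class_def by blast

lemma class_subset: "communicating_class C \<Longrightarrow> C \<subseteq> S"
  unfolding communicating_class_def by blast

lemma class_eq: "communicating_class C \<Longrightarrow> communicating_class D \<Longrightarrow> i \<in> C \<Longrightarrow> i \<in> D \<Longrightarrow> C = D"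
  unfolding communicating_class_def by blast

lemma fixed_zero_on_class:
  assumes "communicating_class C" "fixed x" "i \<in> C" "x i = 0" "j \<in> C"
  shows "x j = 0"
  using fixed_zero_ancestor[OF class_connected[OF assms(1,5,3)] assms(2,4)] .

lemma fixed_pos_on_class:
  assumes C: "communicating_class C" and x: "fixed x" and i: "i \<in> C" "0 < x i" and j: "j \<in> C"
  shows "0 < x j"
proof (rule ccontr)
  assume "\<not> 0 < x j"
  \<comment> \<open>Twice the positive part of \<open>x\<close> is invariant and vanishes at \<open>j\<close>.\<close>
  then have "x i + \<bar>x i\<bar> = 0"
    using fixed_zero_on_class[OF C fixed_linear[OF x fixed_abs[OF x], of 1 1] j _ i(1)] by simp
  then show False using i by simp
qed

text \<open>
  Suitably combined, the two vectors cancel at one node of the class, and an invariant vector with one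
  zero in a class vanishes on all of it.
\<close>

lemma fixed_proportional_on_class:
  assumes C: "communicating_class C" and x: "fixed x" and y: "fixed y"
    and a: "a \<in> C" "y a \<noteq> 0" and i: "i \<in> C"
  shows "x i = x a / y a * y i"
  using fixed_zero_on_class[OF C fixed_linear[OF x y, of 1 "- (x a / y a)"] a(1) _ i] a(2)
  by simp

lemma class_Max_attained:
  assumes "communicating_class C"
  obtains a where "a \<in> C" "x a = Max (x ` C)" "\<And>i. i \<in> C \<Longrightarrow> x i \<le> Max (x ` C)"
proof -
  have "Max (x ` C) \<in> x ` C"
    using assms class_finite by (intro Max_in) (auto simp: communicating_class_def)
  then obtain a where "a \<in> C" "x a = Max (x ` C)"
    by auto
  then show ?thesis
    using class_finite[OF assms] by (intro that[of a]) simp_all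
qed

text \<open>
  On a carrying class \<open>x = c * y\<close> for one factor \<open>c\<close>. Where \<open>x\<close> attains the common maximum this gives
  \<open>c \<ge> 1\<close>, and where \<open>y\<close> does, \<open>c \<le> 1\<close>. That \<open>y\<close> is positive throughout the class excludes a
  negative factor.
\<close>

lemma normalized_unique:
  assumes m: "0 < m" and x: "normalized m x" and y: "normalized m y" and i: "i \<in> S"
  shows "x i = y i"
proof -
  obtain C where C: "communicating_class C" and iC: "i \<in> C"
    using class_exists[OF i] .
  have fx: "fixed x" and fy: "fixed y"
    using x y by (auto simp: normalized_def)
  show ?thesis
  proof (cases "carries_fixed C")
    case False
    then show ?thesis
      using class_carries_fixed_if_nonzero[OF C _ iC] fx fy by metis
  next
    case True
    then have Mx: "Max (x ` C) = m" and My: "Max (y ` C) = m"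
      using x y C by (auto simp: normalized_def)
    obtain a where a: "a \<in> C" "x a = m" and x_le: "\<And>i. i \<in> C \<Longrightarrow> x i \<le> m"
      using class_Max_attained[OF C, of x] Mx by auto
    obtain b where b: "b \<in> C" "y b = m" and y_le: "\<And>i. i \<in> C \<Longrightarrow> y i \<le> m"
      using class_Max_attained[OF C, of y] My by auto
    have ya: "0 < y a"
      using fixed_pos_on_class[OF C fy b(1) _ a(1)] b(2) m by simp
    have proportional: "x j = m / y a * y j" if "j \<in> C" for j
      using fixed_proportional_on_class[OF C fx fy a(1) _ that] ya a(2) by simp
    have "m / y a * m \<le> m"
      using proportional[OF b(1)] x_le[OF b(1)] b(2) by simp
    then have "m \<le> y a"
      using m ya by (simp add: field_simps)
    then have "y a = m"
      using y_le[OF a(1)] by simp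
    then show ?thesis
      using proportional[OF iC] m by simp
  qed
qed

lemma normalized_cong:
  assumes "\<And>i. i \<in> S \<Longrightarrow> x i = y i"
  shows "normalized m x \<longleftrightarrow> normalized m y"
proof -
  have "x ` C = y ` C" if "communicating_class C" for C
    using class_subset[OF that] assms by (intro image_cong) auto
  moreover have "fixed x \<longleftrightarrow> fixed y"
    using assms by (simp add: fixed_def app_def)
  ultimately show ?thesis by (auto simp: normalized_def)
qed

lemma normalized_le:
  assumes m: "0 \<le> m" and x: "normalized m x" and i: "i \<in> S"
  shows "x i \<le> m"
proof -
  obtain C where C: "communicating_class C" and iC: "i \<in> C"
    using class_exists[OF i] .
  show ?thesis
  proof (cases "carries_fixed C")
    case True
    then have "Max (x ` C) = m"
      using x C by (simp add: normalized_def)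
    then show ?thesis
      using class_Max_attained[OF C, of x] iC by metis
  next
    case False
    then have "x i = 0"
      using class_carries_fixed_if_nonzero[OF C _ iC] x by (auto simp: normalized_def)
    then show ?thesis using m by simp
  qed
qed

lemma class_fixed_with_Max:
  assumes C: "communicating_class C" and "carries_fixed C" and m: "0 < m"
  obtains u where "fixed u" "\<And>i. i \<in> S \<Longrightarrow> i \<notin> C \<Longrightarrow> u i = 0" "Max (u ` C) = m"
proof -
  obtain w k where w: "fixed w" "\<And>i. i \<in> S \<Longrightarrow> 0 \<le> w i" "\<And>i. i \<in> S \<Longrightarrow> i \<notin> C \<Longrightarrow> w i = 0"
    and k: "k \<in> C" "w k \<noteq> 0"
    using assms(2) unfolding carries_fixed_def by auto
  obtain a where a: "a \<in> C" "w a = Max (w ` C)" "\<And>i. i \<in> C \<Longrightarrow> w i \<le> w a"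
    using class_Max_attained[OF C, of w] by metis
  have wa: "0 < w a"
    using a(3)[OF k(1)] k w(2)[of k] class_subset[OF C] by fastforce
  \<comment> \<open>Scaling by \<open>m / w a\<close>; the zero summand makes it an instance of closure under linear combinations.\<close>
  let ?u = "\<lambda>i. m / w a * w i + 0 * w i"
  have "Max (?u ` C) = m"
  proof (rule Max_eqI)
    fix y assume "y \<in> ?u ` C"
    then show "y \<le> m" using a(3) wa m by (auto simp: field_simps)
  qed (use class_finite[OF C] a(1) wa in \<open>auto simp: image_iff intro!: bexI[of _ a]\<close>)
  then show thesis
    using w(3) by (intro that[of ?u] fixed_linear w(1)) simp_all
qed

lemma normalized_exists:
  assumes m: "0 < m"
  obtains x where "normalized m x"
proof -
  \<comment> \<open>Distinct classes are disjoint, so the sum over the carrying classes agrees on each with its own term.\<close>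
  let ?K = "{C. communicating_class C \<and> carries_fixed C}"
  have finK: "finite ?K"
    by (rule finite_subset[of _ "Pow S"]) (auto simp: finite_S dest: class_subset)
  have "\<forall>C\<in>?K. \<exists>u. fixed u \<and> (\<forall>i\<in>S. i \<notin> C \<longrightarrow> u i = 0) \<and> Max (u ` C) = m"
  proof
    fix C assume "C \<in> ?K"
    then have C: "communicating_class C" "carries_fixed C" by auto
    show "\<exists>u. fixed u \<and> (\<forall>i\<in>S. i \<notin> C \<longrightarrow> u i = 0) \<and> Max (u ` C) = m"
      by (rule class_fixed_with_Max[OF C m]) blast
  qed
  from bchoice[OF this] obtain u where
    "\<forall>C\<in>?K. fixed (u C) \<and> (\<forall>i\<in>S. i \<notin> C \<longrightarrow> u C i = 0) \<and> Max (u C ` C) = m"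
    by (elim exE)
  then have u: "\<And>C. C \<in> ?K \<Longrightarrow> fixed (u C)"
      "\<And>C i. C \<in> ?K \<Longrightarrow> i \<in> S \<Longrightarrow> i \<notin> C \<Longrightarrow> u C i = 0"
      "\<And>C. C \<in> ?K \<Longrightarrow> Max (u C ` C) = m"
    by blast+
  let ?x = "\<lambda>i. \<Sum>C\<in>?K. u C i"
  have on_class: "?x i = u C i" if C: "C \<in> ?K" and i: "i \<in> C" for C i
  proof -
    have "u D i = 0" if "D \<in> ?K - {C}" for D
      using that C i u(2)[of D i] class_eq[of C D i] class_subset[of C] by blast
    then have "?x i = (\<Sum>D\<in>{C}. u D i)"
      using finK C by (intro sum.mono_neutral_right) auto
    then show ?thesis by simp
  qed
  have "normalized m ?x"
    unfolding normalized_def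
  proof (intro conjI allI impI)
    show "fixed ?x"
      by (rule fixed_sum[OF finK u(1)])
    fix C assume "communicating_class C \<and> carries_fixed C"
    then have C: "C \<in> ?K" by simp
    then have "?x ` C = u C ` C"
      using on_class by (intro image_cong) auto
    then show "Max (?x ` C) = m"
      using u(3)[OF C] by simp
  qed
  then show thesis by (rule that)
qed

lemma carrying_class_exists:
  assumes "carries_fixed S"
  obtains C where "communicating_class C" "carries_fixed C"
proof -
  obtain u i where "fixed u" "i \<in> S" "u i \<noteq> 0"
    using assms unfolding carries_fixed_def by auto
  then show thesis
    using class_exists[of i] class_carries_fixed_if_nonzero that by metis
qed

section \<open>Coordinatewise downward iteration\<close>

text \<open>
  By monotonicity of the kernel a step that replaces one coordinate by its image stays above every
  fixed vector \<open>z\<close> that lies below the start. So the coordinates decrease to a limit \<open>y\<close>. The residual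
  \<open>app y i - y i\<close> is \<open>0\<close> at the nodes used infinitely often, since the residual is exactly the
  increment when a node is used. At a node that fairness does not force to be used, the residual
  is positive all the time, and so it is nonnegative in the limit. Hence \<open>y\<close> is subinvariant, and
  conservation makes it fixed.
\<close>

lemma downward_iteration_converges:
  fixes x :: "nat \<Rightarrow> 'a \<Rightarrow> real" and k :: "nat \<Rightarrow> 'a"
  assumes step: "\<And>n i. i \<in> S \<Longrightarrow> x (Suc n) i = (if i = k n then app (x n) i else x n i)"
    and down: "\<And>n. app (x n) (k n) \<le> x n (k n)"
    and fair: "\<And>i n. i \<in> S \<Longrightarrow> app (x n) i \<le> x n i \<Longrightarrow> infinite {n. k n = i}"
    and z: "fixed z" and z_le: "\<And>i. i \<in> S \<Longrightarrow> z i \<le> x 0 i"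
  obtains y where "\<And>i. i \<in> S \<Longrightarrow> (\<lambda>n. x n i) \<longlonglongrightarrow> y i" "fixed y"
    "\<And>i. i \<in> S \<Longrightarrow> z i \<le> y i" "\<And>i. i \<in> S \<Longrightarrow> y i \<le> x 0 i"
proof -
  have above: "\<forall>i\<in>S. z i \<le> x n i" for n
  proof (induction n)
    case 0
    then show ?case using z_le by simp
  next
    case (Suc n)
    have "z i \<le> app (x n) i" if "i \<in> S" for i
      using app_mono[of z "x n" i] Suc that z by (auto simp: fixed_def)
    then show ?case using Suc step by simp
  qed
  have dec: "decseq (\<lambda>n. x n i)" if "i \<in> S" for i
    unfolding decseq_Suc_iff using step[OF that] down by (metis order_refl)
  have "\<exists>l. (\<lambda>n. x n i) \<longlonglongrightarrow> l" if "i \<in> S" for i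
    using decseq_convergent[OF dec[OF that], of "z i"] above that by metis
  then obtain y where lim: "\<And>i. i \<in> S \<Longrightarrow> (\<lambda>n. x n i) \<longlonglongrightarrow> y i"
    by metis
  have lim_app: "(\<lambda>n. app (x n) i - x n i) \<longlonglongrightarrow> app y i - y i" if "i \<in> S" for i
    unfolding app_def by (intro tendsto_intros lim that)
  have "y i \<le> app y i" if i: "i \<in> S" for i
  proof (cases "\<exists>n. app (x n) i \<le> x n i")
    case True
    then have inf: "infinite {n. k n = i}" using fair[OF i] by blast
    \<comment> \<open>Along the times at which \<open>i\<close> is used, the residual is a difference of consecutive iterates.\<close>
    define t where "t = enumerate {n. k n = i}"
    have t: "strict_mono t" "\<And>n. k (t n) = i"
      using inf enumerate_in_set[OF inf] by (auto simp: t_def strict_mono_enumerate)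
    have "(\<lambda>n. x (Suc n) i - x n i) \<longlonglongrightarrow> y i - y i"
      by (intro tendsto_diff LIMSEQ_Suc lim i)
    from LIMSEQ_subseq_LIMSEQ[OF this t(1)]
    have "(\<lambda>n. app (x (t n)) i - x (t n) i) \<longlonglongrightarrow> 0"
      using step[OF i] t(2) by (simp add: o_def)
    moreover have "(\<lambda>n. app (x (t n)) i - x (t n) i) \<longlonglongrightarrow> app y i - y i"
      using LIMSEQ_subseq_LIMSEQ[OF lim_app[OF i] t(1)] by (simp add: o_def)
    ultimately have "app y i - y i = 0"
      using LIMSEQ_unique by blast
    then show ?thesis by simp
  next
    case False
    then have "0 \<le> app y i - y i"
      by (intro LIMSEQ_le_const[OF lim_app[OF i]]) (auto simp: not_le less_imp_le)
    then show ?thesis by simp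
  qed
  then have "fixed y" by (rule subinvariant_imp_fixed)
  moreover have "z i \<le> y i" if "i \<in> S" for i
    using LIMSEQ_le_const[OF lim[OF that]] above that by blast
  moreover have "y i \<le> x 0 i" if "i \<in> S" for i
    using decseq_ge[OF dec[OF that] lim[OF that]] .
  ultimately show thesis using that lim by blast
qed

text \<open>
  The fixed limit lies between the normalized vector \<open>z\<close> and the constant \<open>m\<close>, so on a carrying class
  it takes the value \<open>m\<close> where \<open>z\<close> does. It is thus normalized itself, and normalized vectors are
  unique.
\<close>

lemma downward_iteration_limit_normalized:
  fixes x :: "nat \<Rightarrow> 'a \<Rightarrow> real" and k :: "nat \<Rightarrow> 'a"
  assumes m: "0 < m" and z: "normalized m z"
    and start: "\<And>i. i \<in> S \<Longrightarrow> x 0 i = m"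
    and step: "\<And>n i. i \<in> S \<Longrightarrow> x (Suc n) i = (if i = k n then app (x n) i else x n i)"
    and down: "\<And>n. app (x n) (k n) \<le> x n (k n)"
    and fair: "\<And>i n. i \<in> S \<Longrightarrow> app (x n) i \<le> x n i \<Longrightarrow> infinite {n. k n = i}"
    and i: "i \<in> S"
  shows "(\<lambda>n. x n i) \<longlonglongrightarrow> z i"
proof -
  obtain y where y: "\<And>i. i \<in> S \<Longrightarrow> (\<lambda>n. x n i) \<longlonglongrightarrow> y i" "fixed y"
      "\<And>i. i \<in> S \<Longrightarrow> z i \<le> y i" "\<And>i. i \<in> S \<Longrightarrow> y i \<le> x 0 i"
  proof (rule downward_iteration_converges[of x k z])
    show "fixed z" using z by (simp add: normalized_def)
    show "z i \<le> x 0 i" if "i \<in> S" for i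
      using normalized_le[OF _ z that] m start[OF that] by simp
  qed (use step down fair in blast)+
  have "normalized m y"
    unfolding normalized_def
  proof (intro conjI allI impI y(2))
    fix C assume "communicating_class C \<and> carries_fixed C"
    then have C: "communicating_class C" and Mz: "Max (z ` C) = m"
      using z by (auto simp: normalized_def)
    obtain a where a: "a \<in> C" "z a = m"
      using class_Max_attained[OF C, of z] Mz by auto
    have y_le: "y i \<le> m" if "i \<in> C" for i
      using y(4)[of i] start[of i] class_subset[OF C] that by auto
    have "y a = m"
      using y(3)[of a] y_le[of a] a class_subset[OF C] by auto
    then show "Max (y ` C) = m"
      using a(1) y_le class_finite[OF C] by (intro Max_eqI) (auto intro: rev_image_eqI)
  qed
  then show ?thesis
    using y(1)[OF i] normalized_unique[OF m _ z i] by simp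
qed

end

section \<open>Eigenvalues of principal submatrices\<close>

lemma bij_betw_pick:
  assumes "C \<subseteq> {0..<N}"
  shows "bij_betw (pick C) {0..<card C} C"
proof (rule bij_betwI')
  fix a b assume "a \<in> {0..<card C}" "b \<in> {0..<card C}"
  then show "(pick C a = pick C b) = (a = b)"
    by (metis atLeastLessThan_iff card_pick_le)
next
  fix a assume "a \<in> {0..<card C}"
  then show "pick C a \<in> C" using pick_in_set_le by simp
next
  fix i assume i: "i \<in> C"
  have "finite C" using assms finite_subset by blast
  then have "card {a \<in> C. a < i} < card C"
    using i by (intro psubset_card_mono) auto
  then show "\<exists>a\<in>{0..<card C}. i = pick C a"
    using pick_card_in_set[OF i] by (intro bexI[of _ "card {a \<in> C. a < i}"]) auto
qed

lemma pick_less: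
  assumes "C \<subseteq> {0..<N}" "a < card C"
  shows "pick C a \<in> C" "pick C a < N"
proof -
  show "pick C a \<in> C" by (rule pick_in_set_le[OF assms(2)])
  then show "pick C a < N" using assms(1) by auto
qed

lemma principal_submatrix:
  assumes A: "A \<in> carrier_mat N N" and C: "C \<subseteq> {0..<N}"
  shows "submatrix A C C = mat (card C) (card C) (\<lambda>(a, b). A $$ (pick C a, pick C b))"
proof -
  have "{i. i < N \<and> i \<in> C} = C" using C by auto
  then show ?thesis using A by (simp add: submatrix_def)
qed

lemma submatrix_full:
  assumes A: "A \<in> carrier_mat N N"
  shows "submatrix A {0..<N} {0..<N} = A"
proof -
  have "pick {0..<N} i = i" if "i < N" for i
  proof -
    have "{a \<in> {0..<N}. a < i} = {0..<i}" using that by auto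
    then show ?thesis using pick_card_in_set[of i "{0..<N}"] that by simp
  qed
  then show ?thesis
    using A unfolding principal_submatrix[OF A subset_refl] by (intro eq_matI) auto
qed

text \<open>
  Eigenvectors of a block are stated as functions on the index set itself. In this form they extend by
  zero to vectors of the full matrix, without a renumbering of rows and columns.
\<close>

lemma eigenvalue_submatrix_iff:
  fixes A :: "'a::comm_ring_1 mat"
  assumes A: "A \<in> carrier_mat N N" and C: "C \<subseteq> {0..<N}"
  shows "eigenvalue (submatrix A C C) k \<longleftrightarrow>
    (\<exists>w. (\<exists>i\<in>C. w i \<noteq> 0) \<and> (\<forall>i\<in>C. (\<Sum>j\<in>C. A $$ (i, j) * w j) = k * w i))"
proof
  let ?B = "submatrix A C C" and ?n = "card C"
  note B = principal_submatrix[OF A C]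
  have B_mult: "(?B *\<^sub>v x) $ a = (\<Sum>b<?n. A $$ (pick C a, pick C b) * x $ b)"
    if "x \<in> carrier_vec ?n" "a < ?n" for x a
    using that by (simp add: B scalar_prod_def lessThan_atLeast0)
  have sum_C: "(\<Sum>b<?n. f (pick C b)) = (\<Sum>j\<in>C. f j)" for f :: "nat \<Rightarrow> 'a"
    using sum.reindex_bij_betw[OF bij_betw_pick[OF C], of f] by (simp add: lessThan_atLeast0)
  have ex_pick: "\<exists>a<?n. i = pick C a" if "i \<in> C" for i
    using bij_betw_imp_surj_on[OF bij_betw_pick[OF C]] that by force
  {
    assume "eigenvalue ?B k"
    then obtain x where x: "x \<in> carrier_vec ?n" "x \<noteq> 0\<^sub>v ?n" "?B *\<^sub>v x = k \<cdot>\<^sub>v x"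
      unfolding eigenvalue_def eigenvector_def by (auto simp: B)
    define w where "w i = x $ the_inv_into {0..<?n} (pick C) i" for i
    have w_pick: "w (pick C a) = x $ a" if "a < ?n" for a
      using the_inv_into_f_f[OF bij_betw_imp_inj_on[OF bij_betw_pick[OF C]]] that
      by (simp add: w_def)
    have "\<exists>a<?n. x $ a \<noteq> 0"
      using x(1,2) by (metis carrier_vecD eq_vecI index_zero_vec)
    then have "\<exists>i\<in>C. w i \<noteq> 0"
      using w_pick pick_less(1)[OF C] by metis
    moreover have "(\<Sum>j\<in>C. A $$ (i, j) * w j) = k * w i" if i: "i \<in> C" for i
    proof -
      obtain a where a: "a < ?n" "i = pick C a" using ex_pick[OF i] by blast
      have "(\<Sum>j\<in>C. A $$ (i, j) * w j) = (\<Sum>b<?n. A $$ (i, pick C b) * w (pick C b))"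
        by (rule sum_C[symmetric])
      also have "\<dots> = (?B *\<^sub>v x) $ a"
        using a by (simp add: B_mult[OF x(1)] w_pick)
      also have "\<dots> = k * w i"
        using x(1,3) a by (simp add: w_pick)
      finally show ?thesis .
    qed
    ultimately show "\<exists>w. (\<exists>i\<in>C. w i \<noteq> 0) \<and> (\<forall>i\<in>C. (\<Sum>j\<in>C. A $$ (i, j) * w j) = k * w i)"
      by blast
  next
    assume "\<exists>w. (\<exists>i\<in>C. w i \<noteq> 0) \<and> (\<forall>i\<in>C. (\<Sum>j\<in>C. A $$ (i, j) * w j) = k * w i)"
    then obtain w i where w: "i \<in> C" "w i \<noteq> 0" "\<And>i. i \<in> C \<Longrightarrow> (\<Sum>j\<in>C. A $$ (i, j) * w j) = k * w i"
      by blast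
    define x where "x = vec ?n (\<lambda>a. w (pick C a))"
    obtain a where a: "a < ?n" "i = pick C a" using ex_pick[OF w(1)] by blast
    have "x $ a \<noteq> 0" using a w(2) by (simp add: x_def)
    then have "x \<noteq> 0\<^sub>v ?n" using a(1) by auto
    moreover have "?B *\<^sub>v x = k \<cdot>\<^sub>v x"
    proof (rule eq_vecI)
      fix b assume "b < dim_vec (k \<cdot>\<^sub>v x)"
      then have b: "b < ?n" by (simp add: x_def)
      have "(?B *\<^sub>v x) $ b = (\<Sum>c<?n. A $$ (pick C b, pick C c) * w (pick C c))"
        using b B_mult[of x b] by (simp add: x_def)
      also have "\<dots> = (\<Sum>j\<in>C. A $$ (pick C b, j) * w j)"
        by (rule sum_C)
      also have "\<dots> = (k \<cdot>\<^sub>v x) $ b"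
        using w(3)[OF pick_less(1)[OF C b]] b by (simp add: x_def)
      finally show "(?B *\<^sub>v x) $ b = (k \<cdot>\<^sub>v x) $ b" .
    qed (simp add: B x_def)
    ultimately show "eigenvalue ?B k"
      unfolding eigenvalue_def eigenvector_def by (intro exI[of _ x]) (simp add: B x_def)
  }
qed

lemma component_eigenvalue_iff:
  fixes P :: "real mat"
  assumes P: "P \<in> carrier_mat N N" and C: "C \<subseteq> {0..<N}"
  shows "eigenvalue (map_mat complex_of_real (submatrix P C C)) k \<longleftrightarrow>
    (\<exists>w. (\<exists>i\<in>C. w i \<noteq> 0) \<and> (\<forall>i\<in>C. (\<Sum>j\<in>C. complex_of_real (P $$ (i, j)) * w j) = k * w i))"
proof -
  let ?A = "map_mat complex_of_real P"
  have A: "?A \<in> carrier_mat N N" using P by simp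
  have "map_mat complex_of_real (submatrix P C C) = submatrix ?A C C"
    unfolding principal_submatrix[OF A C] principal_submatrix[OF P C]
    using P pick_less(2)[OF C] by (intro eq_matI) auto
  moreover have "(\<Sum>j\<in>C. ?A $$ (i, j) * w j) = (\<Sum>j\<in>C. complex_of_real (P $$ (i, j)) * w j)"
    if "i \<in> C" for i and w :: "nat \<Rightarrow> complex"
  proof (rule sum.cong[OF refl])
    fix j assume "j \<in> C"
    then have "i < N" "j < N" using that C by auto
    then show "?A $$ (i, j) * w j = complex_of_real (P $$ (i, j)) * w j" using P by simp
  qed
  ultimately show ?thesis
    by (simp add: eigenvalue_submatrix_iff[OF A C])
qed

section \<open>Nonnegative matrices with a positive left eigenvector\<close>

locale conservative_matrix =
  fixes N :: nat and P :: "real mat" and V :: "real vec"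
  assumes P_carrier: "P \<in> carrier_mat N N"
    and P_nonneg: "\<And>i j. i < N \<Longrightarrow> j < N \<Longrightarrow> 0 \<le> P $$ (i, j)"
    and V_carrier: "V \<in> carrier_vec N"
    and V_pos: "\<And>i. i < N \<Longrightarrow> 0 < V $ i"
    and V_left_eigenvector: "transpose_mat P *\<^sub>v V = V"
begin

sublocale conservative_kernel "{0..<N}" "\<lambda>i j. P $$ (i, j)" "\<lambda>i. V $ i"
proof
  fix j assume j: "j \<in> {0..<N}"
  have "V $ j = (transpose_mat P *\<^sub>v V) $ j"
    by (simp add: V_left_eigenvector)
  also have "\<dots> = (\<Sum>i\<in>{0..<N}. V $ i * P $$ (i, j))"
    using j P_carrier V_carrier by (auto simp: scalar_prod_def mult.commute intro!: sum.cong)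
  finally show "(\<Sum>i\<in>{0..<N}. V $ i * P $$ (i, j)) = V $ j" ..
qed (auto intro: P_nonneg V_pos)

lemma mult_vec_index: "x \<in> carrier_vec N \<Longrightarrow> i < N \<Longrightarrow> (P *\<^sub>v x) $ i = app (\<lambda>j. x $ j) i"
  using P_carrier by (auto simp: app_def scalar_prod_def intro!: sum.cong)

lemma component_radius_attained:
  assumes "C \<subseteq> {0..<N}" "C \<noteq> {}"
  obtains k where "eigenvalue (map_mat complex_of_real (submatrix P C C)) k"
      "cmod k = component_spectral_radius P C"
    and "\<And>l. eigenvalue (map_mat complex_of_real (submatrix P C C)) l \<Longrightarrow>
      cmod l \<le> component_spectral_radius P C"
proof -
  let ?B = "map_mat complex_of_real (submatrix P C C)"
  have B: "?B \<in> carrier_mat (card C) (card C)"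
    using principal_submatrix[OF P_carrier assms(1)] by simp
  have n: "card C > 0"
    using assms finite_subset[OF assms(1)] by (simp add: card_gt_0_iff)
  have spectrum: "spectrum ?B = {k. eigenvalue ?B k}"
    by (simp add: spectrum_def)
  have radius: "component_spectral_radius P C = spectral_radius ?B"
    by (simp add: component_spectral_radius_def real_spectral_radius_def)
  obtain k where "eigenvalue ?B k" "cmod k = component_spectral_radius P C"
    using spectral_radius_mem_max(1)[OF B n] unfolding spectrum radius by auto
  moreover have "cmod l \<le> component_spectral_radius P C" if "eigenvalue ?B l" for l
    using spectral_radius_mem_max(2)[OF B n, of "cmod l"] that unfolding spectrum radius by blast
  ultimately show thesis by (rule that)
qed

text \<open>
  The absolute values of a complex eigenvector for \<open>k\<close>, extended by zero, grow at least by the factor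
  \<open>cmod k\<close> when the kernel is applied. The weighted total does not grow at all, so \<open>cmod k \<le> 1\<close>; and
  in the case of equality the absolute values form a subinvariant, hence fixed, vector.
\<close>

lemma abs_eigenvector_le_app:
  assumes C: "C \<subseteq> {0..<N}"
    and k: "eigenvalue (map_mat complex_of_real (submatrix P C C)) k"
  obtains u where "\<And>i. 0 \<le> u i" "\<And>i. i \<notin> C \<Longrightarrow> u i = 0" "\<exists>i\<in>C. u i \<noteq> 0"
    "\<And>i. i < N \<Longrightarrow> cmod k * u i \<le> app u i"
proof -
  obtain w where w: "\<exists>i\<in>C. w i \<noteq> 0"
      "\<And>i. i \<in> C \<Longrightarrow> (\<Sum>j\<in>C. complex_of_real (P $$ (i, j)) * w j) = k * w i"
    using k component_eigenvalue_iff[OF P_carrier C] by auto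
  let ?u = "\<lambda>i. if i \<in> C then cmod (w i) else 0"
  have "cmod k * ?u i \<le> app ?u i" if i: "i < N" for i
  proof (cases "i \<in> C")
    case True
    then have "cmod k * ?u i = cmod (\<Sum>j\<in>C. complex_of_real (P $$ (i, j)) * w j)"
      by (simp add: w(2) norm_mult)
    also have "\<dots> \<le> (\<Sum>j\<in>C. P $$ (i, j) * ?u j)"
    proof (rule sum_norm_le)
      fix j assume "j \<in> C"
      moreover have "j < N" using \<open>j \<in> C\<close> C by auto
      ultimately show "cmod (complex_of_real (P $$ (i, j)) * w j) \<le> P $$ (i, j) * ?u j"
        using P_nonneg[OF i] by (simp add: norm_mult)
    qed
    also have "\<dots> = app ?u i"
      unfolding app_def using C by (intro sum.mono_neutral_left) auto
    finally show ?thesis .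
  next
    case False
    have "0 \<le> app ?u i"
      unfolding app_def using i P_nonneg by (intro sum_nonneg) auto
    then show ?thesis using False by simp
  qed
  then show thesis
    using w(1) by (intro that[of ?u]) auto
qed

lemma component_eigenvalue_cmod_le_1:
  assumes C: "C \<subseteq> {0..<N}"
    and k: "eigenvalue (map_mat complex_of_real (submatrix P C C)) k"
  shows "cmod k \<le> 1"
proof -
  obtain u where u: "\<And>i. 0 \<le> u i" "\<exists>i\<in>C. u i \<noteq> 0" "\<And>i. i < N \<Longrightarrow> cmod k * u i \<le> app u i"
    using abs_eigenvector_le_app[OF assms] by metis
  let ?t = "\<Sum>i\<in>{0..<N}. V $ i * u i"
  obtain i where i: "i \<in> {0..<N}" "0 < u i"
    using u(1,2) C by (metis order_le_less subsetD)
  then have "0 < ?t"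
    using u(1) V_pos by (intro sum_pos2[of _ i]) (auto simp: less_imp_le)
  moreover have "cmod k * ?t \<le> ?t"
  proof -
    have "cmod k * ?t = (\<Sum>i\<in>{0..<N}. V $ i * (cmod k * u i))"
      by (simp add: sum_distrib_left mult.left_commute)
    also have "\<dots> \<le> (\<Sum>i\<in>{0..<N}. V $ i * app u i)"
      using u(3) V_pos by (intro sum_mono mult_left_mono) (auto simp: less_imp_le)
    also have "\<dots> = ?t" by (rule weight_app)
    finally show ?thesis .
  qed
  ultimately show ?thesis by simp
qed

lemma component_radius_eq_1_iff:
  assumes C: "C \<subseteq> {0..<N}" "C \<noteq> {}"
  shows "component_spectral_radius P C = 1 \<longleftrightarrow> carries_fixed C"
proof -
  obtain k where k: "eigenvalue (map_mat complex_of_real (submatrix P C C)) k"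
      "cmod k = component_spectral_radius P C"
    and max: "\<And>l. eigenvalue (map_mat complex_of_real (submatrix P C C)) l \<Longrightarrow>
      cmod l \<le> component_spectral_radius P C"
    using component_radius_attained[OF C] by metis
  show ?thesis
  proof
    assume "component_spectral_radius P C = 1"
    then obtain u where u: "\<And>i. 0 \<le> u i" "\<And>i. i \<notin> C \<Longrightarrow> u i = 0" "\<exists>i\<in>C. u i \<noteq> 0"
        "\<And>i. i < N \<Longrightarrow> u i \<le> app u i"
      using abs_eigenvector_le_app[OF C(1) k(1)] k(2) by (metis mult_1)
    then show "carries_fixed C"
      unfolding carries_fixed_def using subinvariant_imp_fixed[of u] by auto
  next
    assume "carries_fixed C"
    then obtain u where u: "fixed u" "\<forall>i\<in>{0..<N}. i \<notin> C \<longrightarrow> u i = 0" "\<exists>i\<in>C. u i \<noteq> 0"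
      unfolding carries_fixed_def by blast
    have "(\<Sum>j\<in>C. complex_of_real (P $$ (i, j)) * complex_of_real (u j)) = 1 * complex_of_real (u i)"
      if i: "i \<in> C" for i
    proof -
      have "(\<Sum>j\<in>C. P $$ (i, j) * u j) = app u i"
        unfolding app_def using C u(2) by (intro sum.mono_neutral_left) auto
      also have "\<dots> = u i"
        using u(1) i C(1) by (auto simp: fixed_def)
      finally show ?thesis
        by (simp flip: of_real_mult of_real_sum)
    qed
    then have "eigenvalue (map_mat complex_of_real (submatrix P C C)) 1"
      unfolding component_eigenvalue_iff[OF P_carrier C(1)] using u(3)
      by (intro exI[of _ "\<lambda>i. complex_of_real (u i)"]) auto
    from max[OF this] have "1 \<le> component_spectral_radius P C" by simp
    then show "component_spectral_radius P C = 1"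
      using component_eigenvalue_cmod_le_1[OF C(1) k(1)] k(2) by simp
  qed
qed

lemma reachable_matrix_digraph_iff:
  "i \<rightarrow>\<^sup>*\<^bsub>matrix_digraph P\<^esub> j \<longleftrightarrow> i < N \<and> j < N \<and> (i, j) \<in> arc_rel\<^sup>*"
proof -
  interpret wf_digraph "matrix_digraph P"
    by unfold_locales (auto simp: matrix_digraph_def)
  have arcs: "arcs_ends (matrix_digraph P) = arc_rel"
    using P_carrier by (auto simp: arcs_ends_conv matrix_digraph_def arc_rel_def)
  have verts: "verts (matrix_digraph P) = {0..<N}"
    using P_carrier by (simp add: matrix_digraph_def)
  show ?thesis
  proof
    assume ij: "i \<rightarrow>\<^sup>*\<^bsub>matrix_digraph P\<^esub> j"
    then have "(i, j) \<in> arc_rel\<^sup>*"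
      unfolding reachable_def arcs by (rule rtrancl_on_rtranclI)
    then show "i < N \<and> j < N \<and> (i, j) \<in> arc_rel\<^sup>*"
      using reachable_in_verts[OF ij] verts by auto
  next
    assume "i < N \<and> j < N \<and> (i, j) \<in> arc_rel\<^sup>*"
    then have "(i, j) \<in> arc_rel\<^sup>*" and i: "i \<in> verts (matrix_digraph P)" by (auto simp: verts)
    then show "i \<rightarrow>\<^sup>*\<^bsub>matrix_digraph P\<^esub> j"
      by (induction rule: rtrancl_induct) (auto simp: arcs[symmetric] intro: reachable_adj_trans)
  qed
qed

lemma strong_components_eq: "strong_components P = {C. communicating_class C}"
  unfolding pre_digraph.sccs_verts_def communicating_class_def reachable_matrix_digraph_iff
  by (auto; blast)

lemma class_radius_eq_1_iff:
  "communicating_class C \<Longrightarrow> component_spectral_radius P C = 1 \<longleftrightarrow> carries_fixed C"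
  by (intro component_radius_eq_1_iff) (auto simp: communicating_class_def)

lemma normalized_limit_iff:
  assumes N: "N \<ge> 1" and radius: "real_spectral_radius P = 1"
  shows "normalized_limit N P H \<longleftrightarrow>
    H \<in> carrier_vec N \<and> normalized (1 / real N) (\<lambda>i. (H + uniform_vec N) $ i)"
proof (cases "H \<in> carrier_vec N")
  case True
  define x where "x = H + uniform_vec N"
  have x: "x \<in> carrier_vec N"
    using True by (simp add: x_def uniform_vec_def)
  have fixed_iff: "P *\<^sub>v x = 1 \<cdot>\<^sub>v x \<longleftrightarrow> fixed (\<lambda>i. x $ i)"
    using x P_carrier mult_vec_index[OF x] by (auto simp: vec_eq_iff fixed_def)
  have "carries_fixed {0..<N}"
    using component_radius_eq_1_iff[of "{0..<N}"] N radius submatrix_full[OF P_carrier]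
    by (simp add: component_spectral_radius_def)
  then obtain C where C: "communicating_class C" "carries_fixed C"
    by (rule carrying_class_exists)
  \<comment> \<open>The prescribed maximum on a carrying class makes the vector nonzero.\<close>
  have nonzero: "x \<noteq> 0\<^sub>v N" if "normalized (1 / real N) (\<lambda>i. x $ i)"
  proof
    assume "x = 0\<^sub>v N"
    have "Max ((\<lambda>i. x $ i) ` C) = 1 / real N"
      using that C by (simp add: normalized_def)
    then obtain a where "a \<in> C" "x $ a = 1 / real N"
      using class_Max_attained[OF C(1), of "\<lambda>i. x $ i"] by auto
    then show False
      using \<open>x = 0\<^sub>v N\<close> class_subset[OF C(1)] N by auto
  qed
  have "normalized_limit N P H \<longleftrightarrow> x \<noteq> 0\<^sub>v N \<and> normalized (1 / real N) (\<lambda>i. x $ i)"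
    unfolding normalized_limit_def eigenvector_def normalized_def strong_components_eq
      x_def[symmetric] fixed_iff
    using True x P_carrier class_radius_eq_1_iff by auto
  then show ?thesis
    using True nonzero unfolding x_def by blast
qed (simp add: normalized_limit_def)

section \<open>The D-iteration as a downward iteration\<close>

text \<open>
  With \<open>x = H\<^sub>n + e\<close> the fluid is the residual \<open>P x - x\<close>. So diffusion at \<open>k\<close> adds to \<open>x k\<close> exactly
  the residual, that is, replaces this coordinate by that of \<open>P x\<close>; and the fluid at \<open>k\<close> is nonpositive
  precisely when this does not increase \<open>x k\<close>.
\<close>

lemma fluid_eq_residual:
  assumes s: "\<And>n. s (Suc n) < N" and e: "e \<in> carrier_vec N"
  shows "history P (P *\<^sub>v e - e) s n \<in> carrier_vec N \<and>
    fluid P (P *\<^sub>v e - e) s n =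
      P *\<^sub>v (history P (P *\<^sub>v e - e) s n + e) - (history P (P *\<^sub>v e - e) s n + e)"
proof (induction n)
  case 0
  then show ?case using P_carrier e by simp
next
  case (Suc n)
  let ?h = "history P (P *\<^sub>v e - e) s n" and ?f = "fluid P (P *\<^sub>v e - e) s n"
  let ?J = "unit_diag_mat N (s (Suc n))"
  have dimP: "dim_row P = N" using P_carrier by simp
  have J: "?J \<in> carrier_mat N N" by (simp add: unit_diag_mat_def)
  have h: "?h \<in> carrier_vec N" using Suc by simp
  have f: "?f \<in> carrier_vec N" using Suc P_carrier e h by auto
  define g where "g = ?J *\<^sub>v ?f"
  have g: "g \<in> carrier_vec N" using J f by (simp add: g_def)
  have h': "history P (P *\<^sub>v e - e) s (Suc n) = ?h + g"
    by (simp add: dimP g_def)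
  have "fluid P (P *\<^sub>v e - e) s (Suc n) = (1\<^sub>m N - ?J + P * ?J) *\<^sub>v ?f"
    by (simp add: diffusion_operator_def dimP)
  also have "\<dots> = (1\<^sub>m N - ?J) *\<^sub>v ?f + (P * ?J) *\<^sub>v ?f"
    using J P_carrier f by (intro add_mult_distrib_mat_vec) auto
  also have "\<dots> = (?f - g) + P *\<^sub>v g"
    using J P_carrier f by (simp add: minus_mult_distrib_mat_vec[of _ N N] g_def)
  also have "\<dots> = P *\<^sub>v (?h + g + e) - (?h + g + e)"
  proof -
    have "?h + g + e = (?h + e) + g"
      using h g e by (intro eq_vecI) auto
    moreover have "P *\<^sub>v ((?h + e) + g) = P *\<^sub>v (?h + e) + P *\<^sub>v g"
      using P_carrier h g e by (intro mult_add_distrib_mat_vec) auto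
    moreover have "?f = P *\<^sub>v (?h + e) - (?h + e)" using Suc by simp
    ultimately show ?thesis
      using P_carrier h g e by (intro eq_vecI) auto
  qed
  finally show ?case
    unfolding h' using h g by simp
qed

lemma unit_diag_mat_mult_index:
  assumes "f \<in> carrier_vec N" "k < N" "i < N"
  shows "(unit_diag_mat N k *\<^sub>v f) $ i = (if i = k then f $ i else 0)"
proof -
  have "(unit_diag_mat N k *\<^sub>v f) $ i = (\<Sum>j\<in>{0..<N}. (if i = k \<and> j = k then 1 else 0) * f $ j)"
    using assms by (simp add: unit_diag_mat_def scalar_prod_def)
  also have "\<dots> = (\<Sum>j\<in>{0..<N}. if j = k then (if i = k then f $ j else 0) else 0)"
    by (intro sum.cong) auto
  finally show ?thesis using assms(2) by auto
qed

lemma history_converges: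
  assumes N: "N \<ge> 1"
    and z: "normalized (1 / real N) z"
    and s: "fair_negative_sequence P (P *\<^sub>v uniform_vec N - uniform_vec N) s"
    and i: "i < N"
  shows "(\<lambda>n. history P (P *\<^sub>v uniform_vec N - uniform_vec N) s n $ i) \<longlonglongrightarrow> z i - 1 / real N"
proof -
  define e where "e = uniform_vec N"
  define B where "B = P *\<^sub>v e - e"
  define x where "x n i = (history P B s n + e) $ i" for n i
  have dimP: "dim_row P = N" using P_carrier by simp
  have e: "e \<in> carrier_vec N" and e_index: "\<And>i. i < N \<Longrightarrow> e $ i = 1 / real N"
    by (auto simp: e_def uniform_vec_def)
  have s_less: "s (Suc n) < N" for n
    using s dimP by (simp add: fair_negative_sequence_def)
  have h: "history P B s n \<in> carrier_vec N" for n
    using fluid_eq_residual[where s = s, OF s_less e] by (simp add: B_def)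
  have fluid_index: "fluid P B s n $ i = app (x n) i - x n i" if "i < N" for n i
  proof -
    have "fluid P B s n = P *\<^sub>v (history P B s n + e) - (history P B s n + e)"
      using fluid_eq_residual[where s = s, OF s_less e] by (simp add: B_def)
    then show ?thesis
      using that h[of n] e P_carrier mult_vec_index[of "history P B s n + e" i]
      by (simp add: x_def app_def)
  qed
  have fluid_carrier: "fluid P B s n \<in> carrier_vec N" for n
    using fluid_eq_residual[where s = s, OF s_less e] P_carrier h[of n] e
    by (simp add: B_def)
  have step: "x (Suc n) i = (if i = s (Suc n) then app (x n) i else x n i)"
    if i: "i \<in> {0..<N}" for n i
  proof -
    have "(unit_diag_mat N (s (Suc n)) *\<^sub>v fluid P B s n) $ i =
        (if i = s (Suc n) then fluid P B s n $ i else 0)"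
      using i by (intro unit_diag_mat_mult_index[OF fluid_carrier s_less]) simp
    moreover have "unit_diag_mat N (s (Suc n)) *\<^sub>v fluid P B s n \<in> carrier_vec N"
      by (intro carrier_vecI) (simp add: unit_diag_mat_def)
    ultimately show ?thesis
      using i h[of n] e fluid_index[of i n] by (auto simp: x_def dimP)
  qed
  have "(\<lambda>n. x n i) \<longlonglongrightarrow> z i"
  proof (rule downward_iteration_limit_normalized[where k = "\<lambda>n. s (Suc n)"])
    show "0 < 1 / real N" "normalized (1 / real N) z" "i \<in> {0..<N}"
      using N z i by auto
    show "x 0 i = 1 / real N" if "i \<in> {0..<N}" for i
      using that e e_index dimP by (simp add: x_def)
    show "x (Suc n) i = (if i = s (Suc n) then app (x n) i else x n i)"
      if "i \<in> {0..<N}" for n i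
      using step[OF that] .
    show "app (x n) (s (Suc n)) \<le> x n (s (Suc n))" for n
    proof -
      have "fluid P B s (Suc n - 1) $ s (Suc n) \<le> 0"
        using s unfolding fair_negative_sequence_def B_def e_def by (metis Suc_eq_plus1 le_add2)
      then show ?thesis using fluid_index[OF s_less] by simp
    qed
    show "infinite {n. s (Suc n) = i}" if "i \<in> {0..<N}" "app (x n) i \<le> x n i" for i n
    proof
      assume "finite {n. s (Suc n) = i}"
      then have "finite (Suc ` {n. s (Suc n) = i})" by simp
      moreover have "{n. n \<ge> 1 \<and> s n = i} \<subseteq> Suc ` {n. s (Suc n) = i}"
        by (auto simp: image_iff Suc_le_eq gr0_conv_Suc)
      ultimately have "finite {n. n \<ge> 1 \<and> s n = i}" using finite_subset by blast
      moreover have "i \<in> nonpos_nodes P B s n"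
        using that fluid_index[of i n] dimP by (simp add: nonpos_nodes_def)
      ultimately show False
        using s unfolding fair_negative_sequence_def B_def e_def by blast
    qed
  qed
  then have "(\<lambda>n. x n i - 1 / real N) \<longlonglongrightarrow> z i - 1 / real N"
    by (intro tendsto_intros)
  moreover have "x n i - 1 / real N = history P B s n $ i" for n
    using i h[of n] e e_index by (simp add: x_def)
  ultimately show ?thesis by (simp add: B_def e_def)
qed

end

theorem theorem11:
  fixes N :: nat and P :: "real mat"
  assumes N_pos: "N \<ge> 1"
    and P_dim: "P \<in> carrier_mat N N"
    and P_nonneg: "\<forall>i<N. \<forall>j<N. P $$ (i, j) \<ge> 0"
    and P_radius: "real_spectral_radius P = 1"
    and V_ex: "\<exists>V \<in> carrier_vec N. (\<forall>i<N. V $ i > 0) \<and> transpose_mat P *\<^sub>v V = V"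
  shows "\<exists>H_inf. normalized_limit N P H_inf \<and>
           (\<forall>H. normalized_limit N P H \<longrightarrow> H = H_inf) \<and>
           (\<forall>s. fair_negative_sequence P (P *\<^sub>v uniform_vec N - uniform_vec N) s \<longrightarrow>
              (\<forall>i<N. (\<lambda>n. history P (P *\<^sub>v uniform_vec N - uniform_vec N) s n $ i)
                        \<longlonglongrightarrow> H_inf $ i))"
proof -
  obtain V where "V \<in> carrier_vec N" "\<And>i. i < N \<Longrightarrow> 0 < V $ i" "transpose_mat P *\<^sub>v V = V"
    using V_ex by blast
  then interpret conservative_matrix N P V
    using P_dim P_nonneg by unfold_locales auto
  have pos: "0 < 1 / real N" using N_pos by simp
  obtain z where z: "normalized (1 / real N) z"
    using normalized_exists[OF pos] .
  define H_inf where "H_inf = vec N (\<lambda>i. z i - 1 / real N)"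
  have H_inf: "H_inf \<in> carrier_vec N" "\<And>i. i < N \<Longrightarrow> (H_inf + uniform_vec N) $ i = z i"
    by (auto simp: H_inf_def uniform_vec_def)
  have lim: "normalized_limit N P H_inf"
    using z H_inf normalized_cong[of "\<lambda>i. (H_inf + uniform_vec N) $ i" z]
    by (simp add: normalized_limit_iff[OF N_pos P_radius])
  show ?thesis
  proof (intro exI conjI allI impI)
    show "normalized_limit N P H_inf" by (rule lim)
  next
    fix H assume "normalized_limit N P H"
    then have H: "H \<in> carrier_vec N" "normalized (1 / real N) (\<lambda>i. (H + uniform_vec N) $ i)"
      by (auto simp: normalized_limit_iff[OF N_pos P_radius])
    show "H = H_inf"
    proof (rule eq_vecI)
      fix i assume "i < dim_vec H_inf"
      then have i: "i < N" using H_inf(1) by simp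
      then have "(H + uniform_vec N) $ i = (H_inf + uniform_vec N) $ i"
        using normalized_unique[OF pos H(2) z, of i] H_inf(2) by simp
      then show "H $ i = H_inf $ i"
        using i by (simp add: uniform_vec_def)
    qed (use H H_inf in auto)
  next
    fix s i
    assume "fair_negative_sequence P (P *\<^sub>v uniform_vec N - uniform_vec N) s" and i: "i < N"
    from history_converges[OF N_pos z this]
    show "(\<lambda>n. history P (P *\<^sub>v uniform_vec N - uniform_vec N) s n $ i) \<longlonglongrightarrow> H_inf $ i"
      using i by (simp add: H_inf_def)
  qed
qed

end
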